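(* Let $M$ be a Hausdorff topological group with a left Haar measure $\mu_M$ (in the sense of Fremlin, recalled in the context), and let $\mathcal{H}$ be a complex Hilbert space. If $\{f_k\}_{k\in M}$ is a norm bounded basic Riesz family in $\mathcal{H}$ with respect to $\mu_M$, then $M$ is a discrete group.
   Context: A left Haar measure on a Hausdorff topological group $M$ (Fremlin, Measure Theory, Def. 441D) is a non-zero quasi-Radon measure on $M$ that is invariant under left translations. A quasi-Radon measure is a measure that is complete and locally determined, is defined on all open sets, is $\tau$-additive, is inner regular with respect to closed sets, and is effectively locally finite (every measurable set of positive measure meets some open set of finite measure in a set of positive measure). Any locally compact Hausdorff group with its usual (completed) left Haar measure is an example. Let $\mathcal{K}=\overline{\operatorname{span}}\{f_k\}_{k\in M}$. The family $F=\{f_k\}_{k\in M}$ is a basic frame if $k\mapsto\langle f,f_k\rangle$ is measurable for every $f\in\mathcal{K}$ and there are constants $A,B>0$ such that $A\|f\|^2\le\int_M|\langle f,f_k\rangle|^2\,d\mu_M(k)\le B\|f\|^2$ for all $f\in\mathcal{K}$. It is a basic Riesz family if, moreover, the analysis operator $C_F:\mathcal{H}\to L^2(M,\mu_M)$, $C_Ff=(k\mapsto\langle f,f_k\rangle)$, has dense range. Norm bounded means $\sup_{k\in M}\|f_k\|<\infty$. *)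

theory Defs
  imports "HOL-Analysis.Analysis"
begin

section \<open>Quasi-Radon and left Haar measures\<close>

definition semifinite_measure :: "'a measure \<Rightarrow> bool" where
  "semifinite_measure M \<longleftrightarrow>
     (\<forall>E\<in>sets M. emeasure M E = \<infinity> \<longrightarrow>
        (\<exists>A\<in>sets M. A \<subseteq> E \<and> 0 < emeasure M A \<and> emeasure M A < \<infinity>))"

definition locally_determined :: "'a measure \<Rightarrow> bool" where
  "locally_determined M \<longleftrightarrow> semifinite_measure M \<and>
     (\<forall>E. E \<subseteq> space M \<and> (\<forall>A\<in>sets M. emeasure M A < \<infinity> \<longrightarrow> E \<inter> A \<in> sets M)
        \<longrightarrow> E \<in> sets M)"

definition upward_directed :: "'a set set \<Rightarrow> bool" where
  "upward_directed \<G> \<longleftrightarrow> \<G> \<noteq> {} \<and> (\<forall>G\<in>\<G>. \<forall>H\<in>\<G>. \<exists>K\<in>\<G>. G \<union> H \<subseteq> K)"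

locale quasi_radon_measure = complete_measure M
  for M :: "'a::topological_space measure" +
  assumes space_UNIV: "space M = UNIV"
    and locally_determined: "locally_determined M"
    and open_measurable: "\<And>G. open G \<Longrightarrow> G \<in> sets M"
    and tau_additive: "\<And>\<G>. upward_directed \<G> \<Longrightarrow> (\<And>G. G \<in> \<G> \<Longrightarrow> open G) \<Longrightarrow>
          emeasure M (\<Union>\<G>) = (SUP G\<in>\<G>. emeasure M G)"
    and inner_regular_closed: "\<And>E. E \<in> sets M \<Longrightarrow>
          emeasure M E = (SUP C\<in>{C. closed C \<and> C \<subseteq> E}. emeasure M C)"
    and effectively_locally_finite: "\<And>E. E \<in> sets M \<Longrightarrow> emeasure M E > 0 \<Longrightarrow>
          \<exists>G. open G \<and> emeasure M G < \<infinity> \<and> emeasure M (E \<inter> G) > 0"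

text \<open>
  The group is written additively but need not be commutative, so left translation by
  \<open>g\<close> is \<open>(+) g\<close>.
\<close>

locale left_haar_measure = quasi_radon_measure M
  for M :: "'g::{topological_group_add, t2_space} measure" +
  assumes nonzero: "emeasure M UNIV \<noteq> 0"
    and left_invariant_sets: "\<And>g E. E \<in> sets M \<Longrightarrow> (+) g ` E \<in> sets M"
    and left_invariant: "\<And>g E. E \<in> sets M \<Longrightarrow> emeasure M ((+) g ` E) = emeasure M E"

section \<open>Complex Hilbert spaces\<close>

text \<open>
  The inner product is linear in its first argument. Positive definiteness of \<open>cinner\<close> is
  contained in \<open>cinner_self\<close>.
\<close>

class complex_inner = real_normed_vector +
  fixes scaleC :: "complex \<Rightarrow> 'a \<Rightarrow> 'a"  (infixr \<open>*\<^sub>C\<close> 75)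
    and cinner :: "'a \<Rightarrow> 'a \<Rightarrow> complex"
  assumes scaleC_add_right: "c *\<^sub>C (x + y) = c *\<^sub>C x + c *\<^sub>C y"
    and scaleC_add_left: "(c + d) *\<^sub>C x = c *\<^sub>C x + d *\<^sub>C x"
    and scaleC_scaleC: "c *\<^sub>C d *\<^sub>C x = (c * d) *\<^sub>C x"
    and scaleC_of_real: "complex_of_real r *\<^sub>C x = r *\<^sub>R x"
    and cinner_add_left: "cinner (x + y) z = cinner x z + cinner y z"
    and cinner_scaleC_left: "cinner (c *\<^sub>C x) y = c * cinner x y"
    and cinner_commute: "cinner x y = cnj (cinner y x)"
    and cinner_self: "cinner x x = complex_of_real ((norm x)\<^sup>2)"

class chilbert_space = complex_inner + complete_space

lemma vector_space_scaleC: "vector_space (scaleC :: complex \<Rightarrow> 'a::complex_inner \<Rightarrow> 'a)"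
proof
  show "1 *\<^sub>C x = x" for x :: 'a
    using scaleC_of_real[of 1 x] by simp
qed (simp_all add: scaleC_add_right scaleC_add_left scaleC_scaleC)

definition cspan :: "'a::complex_inner set \<Rightarrow> 'a set" where
  "cspan = module.span scaleC"

section \<open>The space of square integrable functions\<close>

text \<open>
  Functions are not identified modulo null sets, so \<open>L2_norm\<close> is only a seminorm on
  \<open>L2_space M\<close>; density is not affected by passing to the quotient.
\<close>

definition L2_space :: "'a measure \<Rightarrow> ('a \<Rightarrow> complex) set" where
  "L2_space M = {u \<in> borel_measurable M. integrable M (\<lambda>k. (cmod (u k))\<^sup>2)}"

definition L2_norm :: "'a measure \<Rightarrow> ('a \<Rightarrow> complex) \<Rightarrow> real" where
  "L2_norm M u = sqrt (\<integral>k. (cmod (u k))\<^sup>2 \<partial>M)"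

definition L2_dense :: "'a measure \<Rightarrow> ('a \<Rightarrow> complex) set \<Rightarrow> bool" where
  "L2_dense M S \<longleftrightarrow> S \<subseteq> L2_space M \<and>
     (\<forall>u\<in>L2_space M. \<forall>e>0. \<exists>v\<in>S. L2_norm M (\<lambda>k. u k - v k) < e)"

section \<open>Frames and Riesz families\<close>

definition analysis_operator :: "('k \<Rightarrow> 'h::complex_inner) \<Rightarrow> 'h \<Rightarrow> 'k \<Rightarrow> complex" where
  "analysis_operator F f = (\<lambda>k. cinner f (F k))"

definition basic_frame :: "'k measure \<Rightarrow> ('k \<Rightarrow> 'h::chilbert_space) \<Rightarrow> bool" where
  "basic_frame M F \<longleftrightarrow>
     (\<forall>f\<in>closure (cspan (range F)). (\<lambda>k. cinner f (F k)) \<in> borel_measurable M) \<and>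
     (\<exists>A>0. \<exists>B>0. \<forall>f\<in>closure (cspan (range F)).
        ennreal (A * (norm f)\<^sup>2) \<le> (\<integral>\<^sup>+k. ennreal ((cmod (cinner f (F k)))\<^sup>2) \<partial>M) \<and>
        (\<integral>\<^sup>+k. ennreal ((cmod (cinner f (F k)))\<^sup>2) \<partial>M) \<le> ennreal (B * (norm f)\<^sup>2))"

text \<open>
  The analysis operator is defined on all of \<open>\<H>\<close>. That it maps into \<open>L2_space M\<close>, which
  \<open>L2_dense\<close> asks for, already follows from \<open>basic_frame\<close> by orthogonal projection onto the
  closed span of the family.
\<close>

definition basic_riesz_family :: "'k measure \<Rightarrow> ('k \<Rightarrow> 'h::chilbert_space) \<Rightarrow> bool" where
  "basic_riesz_family M F \<longleftrightarrow> basic_frame M F \<and> L2_dense M (range (analysis_operator F))"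

end

theory Submission
  imports Defs
begin

text \<open>
  The proof plays two estimates against each other. On the analytic side, every function in the
  range of the analysis operator \<open>C\<close> is \<open>C h\<close> with \<open>h\<close> in the closed span of the family: replace
  \<open>h\<close> by its orthogonal projection (\<open>ex_orthogonal_projection\<close>). For such \<open>h\<close> the lower
  frame bound and the norm bound \<open>R\<close> of the family give
  \<open>\<bar>C h k\<bar> \<le> R \<parallel>h\<parallel> \<le> R \<parallel>C h\<parallel>\<^sub>2 / \<surd>A\<close>, so a function in the range with small \<open>L\<^sup>2\<close> norm is
  uniformly small. The indicator of a set of small positive measure has small \<open>L\<^sup>2\<close> norm and yet
  takes the value \<open>1\<close>, so it cannot be approximated from the range. As the range is dense, there
  is \<open>\<delta> > 0\<close> such that every measurable set of positive measure has measure at least \<open>\<delta>\<close>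
  (\<open>riesz_family_measure_gap\<close>).

  On the topological side, nonempty open sets have positive Haar measure
  (\<open>left_haar_measure.open_pos\<close>). In a Hausdorff group that is not discrete no point is isolated,
  and so a nonempty open set contains arbitrarily many disjoint nonempty open subsets, each of
  measure at least \<open>\<delta>\<close>. Hence it has infinite measure, whereas effective local finiteness
  provides a nonempty open set of finite measure.
\<close>

section \<open>Orthogonal projection in a complex Hilbert space\<close>

lemma cinner_add_right: "cinner x (y + z) = cinner x y + cinner (x::'a::complex_inner) z"
  by (metis cinner_add_left cinner_commute complex_cnj_add)

lemma cinner_scaleC_right: "cinner x (c *\<^sub>C y) = cnj c * cinner (x::'a::complex_inner) y"
  by (metis cinner_commute cinner_scaleC_left complex_cnj_mult)

lemma scaleC_uminus_one: "(- 1) *\<^sub>C x = - (x::'a::complex_inner)"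
  using scaleC_of_real[of "- 1" x] by simp

lemma cinner_minus_left: "cinner (- x) y = - cinner (x::'a::complex_inner) y"
  using cinner_scaleC_left[of "- 1" x y] by (simp add: scaleC_uminus_one)

lemma cinner_minus_right: "cinner x (- y) = - cinner (x::'a::complex_inner) y"
  using cinner_scaleC_right[of x "- 1" y] by (simp add: scaleC_uminus_one)

lemma norm_add_sq_cinner:
  "(norm (x + y))\<^sup>2 = (norm x)\<^sup>2 + 2 * Re (cinner x y) + (norm (y::'a::complex_inner))\<^sup>2"
proof -
  have "cinner (x + y) (x + y) = cinner x x + cinner x y + (cnj (cinner x y) + cinner y y)"
    by (simp add: cinner_add_left cinner_add_right flip: cinner_commute)
  then have "complex_of_real ((norm (x + y))\<^sup>2) =
      complex_of_real ((norm x)\<^sup>2 + (norm y)\<^sup>2) + (cinner x y + cnj (cinner x y))"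
    by (simp add: cinner_self)
  also have "cinner x y + cnj (cinner x y) = complex_of_real (2 * Re (cinner x y))"
    by (rule complex_add_cnj)
  finally show ?thesis
    by (simp only: of_real_add [symmetric] of_real_eq_iff)
qed

lemma parallelogram_law:
  "(norm (x + y))\<^sup>2 + (norm (x - y))\<^sup>2 = 2 * (norm x)\<^sup>2 + 2 * (norm (y::'a::complex_inner))\<^sup>2"
  using norm_add_sq_cinner[of x y] norm_add_sq_cinner[of x "- y"]
  by (simp add: cinner_minus_right)

lemma norm_scaleC: "norm (c *\<^sub>C x) = cmod c * norm (x::'a::complex_inner)"
proof -
  have "complex_of_real ((norm (c *\<^sub>C x))\<^sup>2) = (c * cnj c) * complex_of_real ((norm x)\<^sup>2)"
    by (simp only: cinner_self [symmetric] cinner_scaleC_left cinner_scaleC_right mult_ac)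
  also have "\<dots> = complex_of_real ((cmod c * norm x)\<^sup>2)"
    by (simp only: power_mult_distrib of_real_mult complex_norm_square [of c])
  finally have "(norm (c *\<^sub>C x))\<^sup>2 = (cmod c * norm x)\<^sup>2"
    by (simp only: of_real_eq_iff)
  then show ?thesis
    by (simp add: power2_eq_iff_nonneg)
qed

text \<open>
  The coefficient \<open>c = \<langle>x, y\<rangle> / \<parallel>y\<parallel>\<^sup>2\<close> makes \<open>x - c y\<close> the component of \<open>x\<close> orthogonal to \<open>y\<close>.
  Both the Cauchy-Schwarz inequality and the orthogonality of a shortest difference vector follow
  by comparing its norm with \<open>0\<close> and with \<open>\<parallel>x\<parallel>\<close>.
\<close>

lemma ex_norm_sq_remove_component:
  fixes x y :: "'a::complex_inner"
  assumes "y \<noteq> 0"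
  shows "\<exists>c. (norm (x - c *\<^sub>C y))\<^sup>2 = (norm x)\<^sup>2 - (cmod (cinner x y))\<^sup>2 / (norm y)\<^sup>2"
proof
  define c where "c = cinner x y / complex_of_real ((norm y)\<^sup>2)"
  define r where "r = (cmod (cinner x y))\<^sup>2 / (norm y)\<^sup>2"
  have "complex_of_real r = cinner x y * cnj (cinner x y) / complex_of_real ((norm y)\<^sup>2)"
    by (simp only: r_def of_real_divide complex_norm_square [of "cinner x y"])
  also have "\<dots> = cnj c * cinner x y"
    by (simp only: c_def complex_cnj_divide complex_cnj_complex_of_real times_divide_eq_left
        mult.commute [of "cnj (cinner x y)"])
  finally have "cnj c * cinner x y = complex_of_real r" ..
  then have re: "Re (cinner x (- (c *\<^sub>C y))) = - r"
    by (simp add: cinner_minus_right cinner_scaleC_right)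
  have "(norm (c *\<^sub>C y))\<^sup>2 = r"
    using assms
    by (simp add: norm_scaleC c_def r_def norm_divide norm_mult norm_power power_mult_distrib
        power_divide power2_eq_square)
  then show "(norm (x - c *\<^sub>C y))\<^sup>2 = (norm x)\<^sup>2 - (cmod (cinner x y))\<^sup>2 / (norm y)\<^sup>2"
    using norm_add_sq_cinner[of x "- (c *\<^sub>C y)"] re by (simp add: r_def)
qed

lemma cinner_zero_right: "cinner x (0::'a::complex_inner) = 0"
  using cinner_scaleC_right[of x 0 0] scaleC_of_real[of 0 "0::'a"] by simp

lemma cinner_eq_0_if_minimal:
  fixes x y :: "'a::complex_inner"
  assumes min: "\<And>c. norm x \<le> norm (x - c *\<^sub>C y)"
  shows "cinner x y = 0"
proof (cases "y = 0")
  case True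
  then show ?thesis
    by (simp add: cinner_zero_right)
next
  case False
  then obtain c where "(norm (x - c *\<^sub>C y))\<^sup>2 = (norm x)\<^sup>2 - (cmod (cinner x y))\<^sup>2 / (norm y)\<^sup>2"
    using ex_norm_sq_remove_component by blast
  moreover have "(norm x)\<^sup>2 \<le> (norm (x - c *\<^sub>C y))\<^sup>2"
    using min by (simp add: power_mono)
  ultimately have "(cmod (cinner x y))\<^sup>2 / (norm y)\<^sup>2 \<le> 0" by simp
  then show ?thesis
    using False by (simp add: divide_le_0_iff)
qed

lemma cauchy_schwarz: "cmod (cinner x y) \<le> norm x * norm (y::'a::complex_inner)"
proof (cases "y = 0")
  case True
  then show ?thesis
    by (simp add: cinner_zero_right)
next
  case False
  then obtain c where "(norm (x - c *\<^sub>C y))\<^sup>2 = (norm x)\<^sup>2 - (cmod (cinner x y))\<^sup>2 / (norm y)\<^sup>2"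
    using ex_norm_sq_remove_component by blast
  then have "(cmod (cinner x y))\<^sup>2 / (norm y)\<^sup>2 \<le> (norm x)\<^sup>2"
    using zero_le_power2[of "norm (x - c *\<^sub>C y)"] by linarith
  then have "(cmod (cinner x y))\<^sup>2 \<le> (norm x * norm y)\<^sup>2"
    unfolding power_mult_distrib using False by (subst (asm) pos_divide_le_eq) simp_all
  then show ?thesis
    by (rule power2_le_imp_le) simp
qed

text \<open>
  A sequence in \<open>S\<close> whose distance to \<open>x\<close> tends to the infimum is Cauchy by the parallelogram
  law, because the midpoint of two of its terms is again in \<open>S\<close>. Its limit is a closest point of
  the closure, and the difference to \<open>x\<close> is orthogonal to \<open>S\<close> by minimality.
\<close>

lemma ex_orthogonal_projection:
  fixes S :: "'a::chilbert_space set"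
  assumes S0: "0 \<in> S"
    and Sadd: "\<And>x y. x \<in> S \<Longrightarrow> y \<in> S \<Longrightarrow> x + y \<in> S"
    and Sscale: "\<And>c x. x \<in> S \<Longrightarrow> c *\<^sub>C x \<in> S"
  shows "\<exists>p\<in>closure S. \<forall>y\<in>S. cinner (x - p) y = 0"
proof -
  define d where "d = Inf ((\<lambda>s. (norm (x - s))\<^sup>2) ` S)"
  have bdd: "bdd_below ((\<lambda>s. (norm (x - s))\<^sup>2) ` S)"
    by (rule bdd_belowI[of _ 0]) auto
  have d_le: "d \<le> (norm (x - s))\<^sup>2" if "s \<in> S" for s
    unfolding d_def using bdd that by (auto intro: cInf_lower)
  have "\<exists>s\<in>S. (norm (x - s))\<^sup>2 < d + inverse (real (Suc n))" for n
  proof -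
    have "Inf ((\<lambda>s. (norm (x - s))\<^sup>2) ` S) < d + inverse (real (Suc n))"
      by (simp add: d_def)
    then show ?thesis
      using bdd S0 by (subst (asm) cInf_less_iff) auto
  qed
  then obtain g where gS: "\<And>n. g n \<in> S"
    and g_lt: "\<And>n. (norm (x - g n))\<^sup>2 < d + inverse (real (Suc n))"
    by metis
  have dist: "(norm (g m - g n))\<^sup>2 \<le> 2 * inverse (real (Suc m)) + 2 * inverse (real (Suc n))"
    for m n
  proof -
    define q where "q = complex_of_real (1/2) *\<^sub>C (g m + g n)"
    have "q \<in> S"
      unfolding q_def by (intro Sscale Sadd gS)
    moreover have "(x - g m) + (x - g n) = 2 *\<^sub>R (x - q)"
      by (simp only: q_def scaleC_of_real)
        (simp add: algebra_simps scaleR_2)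
    then have "(norm ((x - g m) + (x - g n)))\<^sup>2 = 4 * (norm (x - q))\<^sup>2"
      by (simp add: power_mult_distrib)
    moreover have "norm ((x - g m) - (x - g n)) = norm (g m - g n)"
      by (simp add: norm_minus_commute)
    ultimately show ?thesis
      using parallelogram_law[of "x - g m" "x - g n"] g_lt[of m] g_lt[of n] d_le[of q] by simp
  qed
  have "Cauchy g"
  proof (rule CauchyI)
    fix e :: real
    assume e: "0 < e"
    then have "0 < e\<^sup>2 / 4" by simp
    then obtain N where N: "inverse (real (Suc N)) < e\<^sup>2 / 4"
      using reals_Archimedean by blast
    have "norm (g m - g n) < e" if "m \<ge> N" "n \<ge> N" for m n
    proof -
      have "inverse (real (Suc m)) \<le> inverse (real (Suc N))"
        "inverse (real (Suc n)) \<le> inverse (real (Suc N))"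
        using that by (simp_all add: le_imp_inverse_le)
      then have "(norm (g m - g n))\<^sup>2 < e\<^sup>2"
        using dist[of m n] N by linarith
      then show ?thesis
        using e by (simp add: power_less_imp_less_base)
    qed
    then show "\<exists>N. \<forall>m\<ge>N. \<forall>n\<ge>N. norm (g m - g n) < e" by blast
  qed
  then obtain p where p: "g \<longlonglongrightarrow> p"
    using Cauchy_convergent_iff convergent_def by blast
  have "p \<in> closure S"
    using p gS closure_sequential by blast
  moreover have "cinner (x - p) y = 0" if y: "y \<in> S" for y
  proof (rule cinner_eq_0_if_minimal)
    fix c
    have "(\<lambda>n. (norm (x - g n))\<^sup>2) \<longlonglongrightarrow> (norm (x - p))\<^sup>2"
      by (intro tendsto_intros p)
    moreover have "(\<lambda>n. d + inverse (real (Suc n))) \<longlonglongrightarrow> d + 0"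
      by (intro tendsto_intros LIMSEQ_inverse_real_of_nat)
    ultimately have "(norm (x - p))\<^sup>2 \<le> d + 0"
      by (rule LIMSEQ_le) (use g_lt less_imp_le in blast)
    moreover have "d \<le> (norm (x - p - c *\<^sub>C y))\<^sup>2"
    proof (rule LIMSEQ_le_const)
      show "(\<lambda>n. (norm (x - g n - c *\<^sub>C y))\<^sup>2) \<longlonglongrightarrow> (norm (x - p - c *\<^sub>C y))\<^sup>2"
        by (intro tendsto_intros p)
      have "d \<le> (norm (x - g n - c *\<^sub>C y))\<^sup>2" for n
        using d_le[OF Sadd[OF gS Sscale[OF y]], of n c] by (simp add: algebra_simps)
      then show "\<exists>N. \<forall>n\<ge>N. d \<le> (norm (x - g n - c *\<^sub>C y))\<^sup>2" by blast
    qed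
    ultimately have "(norm (x - p))\<^sup>2 \<le> (norm (x - p - c *\<^sub>C y))\<^sup>2" by linarith
    then show "norm (x - p) \<le> norm (x - p - c *\<^sub>C y)"
      by (rule power2_le_imp_le) simp
  qed
  ultimately show ?thesis by blast
qed

text \<open>
  The analysis operator pairs with the family only, so it vanishes on the orthogonal complement
  of the closed span; its range is already attained where the frame bounds apply.
\<close>

lemma analysis_operator_closed_span:
  fixes F :: "'k \<Rightarrow> 'h::chilbert_space"
  shows "\<exists>p\<in>closure (cspan (range F)). analysis_operator F p = analysis_operator F h"
proof -
  interpret vector_space "scaleC :: complex \<Rightarrow> 'h \<Rightarrow> 'h"
    by (rule vector_space_scaleC)
  obtain p where p: "p \<in> closure (cspan (range F))"
    and orth: "\<And>y. y \<in> cspan (range F) \<Longrightarrow> cinner (h - p) y = 0"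
    using ex_orthogonal_projection[of "cspan (range F)" h]
    unfolding cspan_def by (auto intro: span_zero span_add span_scale)
  have "cinner p (F k) = cinner h (F k)" for k
    using orth[of "F k"] cinner_add_left[of "h - p" p "F k"]
    by (simp add: cspan_def span_base)
  with p show ?thesis
    by (auto simp: analysis_operator_def)
qed

section \<open>Sets of small positive measure\<close>

text \<open>
  The constant is \<open>\<delta> = A / (16 R\<^sup>2)\<close>. If \<open>m\<close> is the measure of \<open>E\<close> and \<open>v = C h\<close> approximates
  the indicator of \<open>E\<close> up to \<open>\<surd>m / 2\<close> in \<open>L\<^sup>2\<close>, then \<open>A \<parallel>h\<parallel>\<^sup>2 \<le> \<parallel>v\<parallel>\<^sub>2\<^sup>2 \<le> 4 m\<close>. For \<open>m < \<delta>\<close> this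
  forces \<open>\<bar>v\<bar> \<le> 1/2\<close> everywhere, so that \<open>v\<close> misses the indicator by at least \<open>1/2\<close> on all of
  \<open>E\<close>, an error of at least \<open>\<surd>m / 2\<close>.
\<close>

lemma riesz_family_measure_gap:
  fixes F :: "'k \<Rightarrow> 'h::chilbert_space"
  assumes riesz: "basic_riesz_family M F" and bdd: "bounded (range F)"
  shows "\<exists>\<delta>>0. \<forall>E\<in>sets M. 0 < emeasure M E \<longrightarrow> ennreal \<delta> \<le> emeasure M E"
proof -
  obtain R where R: "R > 0" and norm_F: "\<And>k. norm (F k) \<le> R"
    using bdd unfolding bounded_pos by auto
  have dense: "L2_dense M (range (analysis_operator F))"
    using riesz by (simp add: basic_riesz_family_def)
  obtain A where A: "A > 0"
    and lower: "\<And>h. h \<in> closure (cspan (range F)) \<Longrightarrow>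
        ennreal (A * (norm h)\<^sup>2) \<le> (\<integral>\<^sup>+k. ennreal ((cmod (cinner h (F k)))\<^sup>2) \<partial>M)"
    using riesz unfolding basic_riesz_family_def basic_frame_def by blast
  define \<delta> where "\<delta> = A / (16 * R\<^sup>2)"
  have "ennreal \<delta> \<le> emeasure M E" if E: "E \<in> sets M" and pos: "0 < emeasure M E" for E
  proof (rule ccontr)
    assume "\<not> ennreal \<delta> \<le> emeasure M E"
    then have less: "emeasure M E < ennreal \<delta>" by simp
    then have fin: "emeasure M E < \<infinity>"
      using less_trans ennreal_less_top by fastforce
    define m where "m = measure M E"
    have em: "emeasure M E = ennreal m"
      unfolding m_def using fin by (simp add: emeasure_eq_ennreal_measure less_top)
    have m: "m > 0" "m < \<delta>"
      using pos less unfolding em by (auto simp: ennreal_less_iff m_def)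
    define u :: "'k \<Rightarrow> complex" where "u = indicator E"
    have u_sq: "(cmod (u k))\<^sup>2 = indicator E k" for k
      by (simp add: u_def indicator_def)
    have int_ind: "integrable M (indicator E :: 'k \<Rightarrow> real)"
      using E fin by (simp add: integrable_indicator_iff)
    have "u \<in> borel_measurable M"
      unfolding u_def using E by simp
    then have uL2: "u \<in> L2_space M"
      using int_ind by (simp add: L2_space_def u_sq)
    obtain h where h: "h \<in> closure (cspan (range F))"
      and approx: "L2_norm M (\<lambda>k. u k - analysis_operator F h k) < sqrt (m / 4)"
    proof -
      have "sqrt (m / 4) > 0" using m by simp
      then obtain h0 where
        "L2_norm M (\<lambda>k. u k - analysis_operator F h0 k) < sqrt (m / 4)"
        using dense uL2 unfolding L2_dense_def by blast
      then show ?thesis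
        using that analysis_operator_closed_span[of F h0] by metis
    qed
    define v where "v = analysis_operator F h"
    have vL2: "v \<in> L2_space M"
      using dense by (auto simp: L2_dense_def v_def)
    have v_meas: "v \<in> borel_measurable M" and v_int: "integrable M (\<lambda>k. (cmod (v k))\<^sup>2)"
      using vL2 by (auto simp: L2_space_def)
    have sq_le: "(cmod (a + b))\<^sup>2 \<le> 2 * (cmod a)\<^sup>2 + 2 * (cmod b)\<^sup>2" for a b :: complex
    proof -
      have "(cmod (a + b))\<^sup>2 \<le> (cmod a + cmod b)\<^sup>2"
        by (intro power_mono norm_triangle_ineq) simp
      then show ?thesis
        using sum_squares_bound[of "cmod a" "cmod b"] by (simp add: power2_sum)
    qed
    have diff_int: "integrable M (\<lambda>k. (cmod (u k - v k))\<^sup>2)"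
    proof (rule Bochner_Integration.integrable_bound)
      show "integrable M (\<lambda>k. 2 * indicator E k + 2 * (cmod (v k))\<^sup>2)"
        using int_ind v_int by simp
      show "(\<lambda>k. (cmod (u k - v k))\<^sup>2) \<in> borel_measurable M"
        using v_meas \<open>u \<in> borel_measurable M\<close> by measurable
      show "AE k in M. norm ((cmod (u k - v k))\<^sup>2) \<le> norm (2 * indicator E k + 2 * (cmod (v k))\<^sup>2)"
        using sq_le[of "u k" "- v k" for k] by (simp add: u_sq)
    qed
    have diff_lt: "(\<integral>k. (cmod (u k - v k))\<^sup>2 \<partial>M) < m / 4"
      using approx by (simp add: L2_norm_def v_def)
    have "(\<integral>k. (cmod (v k))\<^sup>2 \<partial>M) \<le> (\<integral>k. 2 * indicator E k + 2 * (cmod (u k - v k))\<^sup>2 \<partial>M)"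
    proof (rule integral_mono)
      show "integrable M (\<lambda>k. 2 * indicator E k + 2 * (cmod (u k - v k))\<^sup>2)"
        using int_ind diff_int by simp
      show "(cmod (v k))\<^sup>2 \<le> 2 * indicator E k + 2 * (cmod (u k - v k))\<^sup>2" for k
        using sq_le[of "u k" "v k - u k"] by (simp add: u_sq norm_minus_commute)
    qed (rule v_int)
    also have "\<dots> = 2 * m + 2 * (\<integral>k. (cmod (u k - v k))\<^sup>2 \<partial>M)"
      using int_ind diff_int E by (simp add: m_def)
    finally have v_le: "(\<integral>k. (cmod (v k))\<^sup>2 \<partial>M) \<le> 4 * m"
      using diff_lt m by linarith
    have "ennreal (A * (norm h)\<^sup>2) \<le> ennreal (\<integral>k. (cmod (v k))\<^sup>2 \<partial>M)"
      using lower[OF h] nn_integral_eq_integral[OF v_int]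
      by (simp add: v_def analysis_operator_def)
    then have h_le: "A * (norm h)\<^sup>2 \<le> 4 * m"
      using v_le by (simp add: ennreal_le_iff)
    have v_small: "cmod (v k) \<le> 1 / 2" for k
    proof -
      have "cmod (v k) \<le> norm h * R"
        unfolding v_def analysis_operator_def
        using cauchy_schwarz[of h "F k"] norm_F[of k]
        by (meson mult_left_mono norm_ge_zero order_trans)
      also have "norm h * R \<le> 1 / 2"
      proof (rule power2_le_imp_le)
        have "16 * R\<^sup>2 * m < A"
          using m R by (simp add: \<delta>_def field_simps)
        moreover have "A * (norm h)\<^sup>2 * (4 * R\<^sup>2) \<le> 4 * m * (4 * R\<^sup>2)"
          using h_le by (intro mult_right_mono) auto
        ultimately have "A * (4 * (norm h * R)\<^sup>2) \<le> A * 1"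
          by (simp add: power_mult_distrib algebra_simps)
        then show "(norm h * R)\<^sup>2 \<le> (1 / 2)\<^sup>2"
          using A by (simp add: power_divide)
      qed simp
      finally show ?thesis .
    qed
    have "m / 4 = (\<integral>k. (1/4) * indicator E k \<partial>M)"
      using E by (simp add: m_def)
    also have "\<dots> \<le> (\<integral>k. (cmod (u k - v k))\<^sup>2 \<partial>M)"
    proof (rule integral_mono)
      show "integrable M (\<lambda>k. (1/4) * indicator E k :: real)"
        using int_ind by simp
      show "(1/4) * indicator E k \<le> (cmod (u k - v k))\<^sup>2" for k
      proof (cases "k \<in> E")
        case True
        have "1 / 2 \<le> cmod (u k - v k)"
          using norm_triangle_ineq2[of "u k" "v k"] v_small[of k] True by (simp add: u_def)
        then have "(1 / 2)\<^sup>2 \<le> (cmod (u k - v k))\<^sup>2"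
          by (intro power_mono) auto
        then show ?thesis
          using True by (simp add: power_divide)
      qed simp
    qed (rule diff_int)
    finally show False
      using diff_lt by simp
  qed
  moreover have "\<delta> > 0"
    using A R by (simp add: \<delta>_def)
  ultimately show ?thesis by blast
qed

section \<open>Open sets in topological groups\<close>

lemma open_left_translation:
  fixes U :: "'g::topological_group_add set"
  assumes "open U"
  shows "open ((+) g ` U)"
proof -
  have "(+) g ` U = (\<lambda>x. - g + x) -` U"
  proof (intro set_eqI iffI)
    fix x
    assume "x \<in> (\<lambda>x. - g + x) -` U"
    then show "x \<in> (+) g ` U"
      by (intro image_eqI[of _ _ "- g + x"]) (auto simp: add.assoc[symmetric])
  qed (auto simp: add.assoc[symmetric])
  then show ?thesis
    using assms by (auto intro!: open_vimage continuous_intros)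
qed

text \<open>
  If a nonempty open set were null, its finite unions of translates would form an upward directed
  family of null open sets that covers the group. By \<open>\<tau>\<close>-additivity the group would be null.
\<close>

lemma (in left_haar_measure) open_pos:
  assumes U: "open U" "U \<noteq> {}"
  shows "0 < emeasure M U"
proof (rule ccontr)
  assume "\<not> 0 < emeasure M U"
  then have null: "emeasure M U = 0" by simp
  have Um: "U \<in> sets M" using U open_measurable by blast
  define \<G> where "\<G> = (\<lambda>T. \<Union>g\<in>T. (+) g ` U) ` {T. finite T}"
  have "upward_directed \<G>"
    unfolding upward_directed_def
  proof (intro conjI ballI)
    show "\<G> \<noteq> {}" by (auto simp: \<G>_def)
    fix G H assume "G \<in> \<G>" "H \<in> \<G>"
    then obtain S T where ST: "finite S" "G = (\<Union>g\<in>S. (+) g ` U)"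
      "finite T" "H = (\<Union>g\<in>T. (+) g ` U)"
      by (auto simp: \<G>_def)
    then have "(\<Union>g\<in>S \<union> T. (+) g ` U) \<in> \<G>"
      unfolding \<G>_def by (intro imageI) simp
    moreover have "G \<union> H \<subseteq> (\<Union>g\<in>S \<union> T. (+) g ` U)"
      using ST by blast
    ultimately show "\<exists>K\<in>\<G>. G \<union> H \<subseteq> K" by blast
  qed
  moreover have "open G" if "G \<in> \<G>" for G
    using that U by (auto simp: \<G>_def intro!: open_UN open_left_translation)
  ultimately have "emeasure M (\<Union>\<G>) = (SUP G\<in>\<G>. emeasure M G)"
    by (rule tau_additive)
  also have "\<dots> = 0"
  proof -
    have "emeasure M G = 0" if G: "G \<in> \<G>" for G
    proof -
      obtain T where T: "finite T" "G = (\<Union>g\<in>T. (+) g ` U)"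
        using G by (auto simp: \<G>_def)
      have "(+) g ` U \<in> null_sets M" for g
        using left_invariant[OF Um] left_invariant_sets[OF Um] null by (auto intro: null_setsI)
      then have "G \<in> null_sets M"
        unfolding T by (intro null_sets.finite_UN T) auto
      then show ?thesis by auto
    qed
    then show ?thesis
      using \<open>upward_directed \<G>\<close> by (intro SUP_eq_const) (auto simp: upward_directed_def)
  qed
  also have "\<Union>\<G> = UNIV"
  proof -
    obtain y where y: "y \<in> U" using U by blast
    have "x \<in> \<Union>\<G>" for x
    proof
      show "(\<Union>g\<in>{x - y}. (+) g ` U) \<in> \<G>"
        unfolding \<G>_def by (rule imageI) simp
      show "x \<in> (\<Union>g\<in>{x - y}. (+) g ` U)"
        using y by (auto intro!: image_eqI[of _ _ y])
    qed
    then show ?thesis by blast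
  qed
  finally show False
    using nonzero by simp
qed

text \<open>
  Without isolated points a nonempty open set contains two disjoint ones. One of them
  accounts for one \<open>\<delta>\<close>, and the other can be split again.
\<close>

lemma open_measure_ge_multiple:
  fixes M :: "'a::t2_space measure"
  assumes meas: "\<And>U. open U \<Longrightarrow> U \<in> sets M"
    and gap: "\<And>U. open U \<Longrightarrow> U \<noteq> {} \<Longrightarrow> ennreal \<delta> \<le> emeasure M U"
    and no_isolated: "\<And>x::'a. \<not> open {x}"
  shows "open G \<Longrightarrow> G \<noteq> {} \<Longrightarrow> of_nat n * ennreal \<delta> \<le> emeasure M G"
proof (induction n arbitrary: G)
  case 0
  then show ?case by simp
next
  case (Suc n)
  obtain x where x: "x \<in> G" using Suc.prems by blast
  then obtain y where y: "y \<in> G" "y \<noteq> x"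
    using Suc.prems no_isolated[of x] by (metis is_singletonI' is_singleton_the_elem singletonD)
  obtain U V where UV: "open U" "open V" "x \<in> U" "y \<in> V" "U \<inter> V = {}"
    using hausdorff[of x y] y by metis
  have "of_nat (Suc n) * ennreal \<delta> = ennreal \<delta> + of_nat n * ennreal \<delta>"
    by (simp add: distrib_right)
  also have "\<dots> \<le> emeasure M (G \<inter> U) + emeasure M (G \<inter> V)"
  proof (rule add_mono)
    show "ennreal \<delta> \<le> emeasure M (G \<inter> U)"
      using Suc.prems UV x by (intro gap) auto
    show "of_nat n * ennreal \<delta> \<le> emeasure M (G \<inter> V)"
      using Suc.prems UV y by (intro Suc.IH) auto
  qed
  also have "\<dots> = emeasure M (G \<inter> U \<union> G \<inter> V)"
    using Suc.prems UV by (intro plus_emeasure meas) auto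
  also have "\<dots> \<le> emeasure M G"
    using Suc.prems by (intro emeasure_mono meas) auto
  finally show ?case .
qed

section \<open>Discreteness\<close>

theorem proposition3p4:
  fixes \<mu> :: "'g::{topological_group_add, t2_space} measure"
    and f :: "'g \<Rightarrow> 'h::chilbert_space"
  assumes haar: "left_haar_measure \<mu>"
    and riesz: "basic_riesz_family \<mu> f"
    and norm_bounded: "bounded (range f)"
  shows "(euclidean :: 'g topology) = discrete_topology UNIV"
proof -
  interpret left_haar_measure \<mu> by (rule haar)
  obtain \<delta> where \<delta>: "\<delta> > 0"
    and gap: "\<And>E. E \<in> sets \<mu> \<Longrightarrow> 0 < emeasure \<mu> E \<Longrightarrow> ennreal \<delta> \<le> emeasure \<mu> E"
    using riesz_family_measure_gap[OF riesz norm_bounded] by blast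
  have "open {x}" for x :: 'g
  proof (rule ccontr)
    assume "\<not> open {x}"
    then have no_isolated: "\<not> open {y}" for y :: 'g
      using open_left_translation[of "{y}" "x - y"] by auto
    obtain G where G: "open G" "emeasure \<mu> G < \<infinity>" "emeasure \<mu> (UNIV \<inter> G) > 0"
      using effectively_locally_finite[of UNIV] nonzero open_measurable[OF open_UNIV]
      by (auto simp: zero_less_iff_neq_zero)
    then have "G \<noteq> {}" by auto
    then have ge: "of_nat n * ennreal \<delta> \<le> emeasure \<mu> G" for n
      using open_measure_ge_multiple[of \<mu> \<delta> G n] G open_measurable no_isolated gap open_pos
      by blast
    obtain r where r: "r \<ge> 0" "emeasure \<mu> G = ennreal r"
      using G by (cases "emeasure \<mu> G") auto
    obtain n where n: "r < real n * \<delta>"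
      using \<delta> reals_Archimedean3 by blast
    have "ennreal (real n * \<delta>) \<le> ennreal r"
      using ge[of n] \<delta> r by (simp add: ennreal_mult ennreal_of_nat_eq_real_of_nat)
    then show False
      using n r by (simp add: ennreal_le_iff)
  qed
  then show ?thesis
    by (metis discrete_topology_unique open_openin topspace_euclidean)
qed

end
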